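(* Let $n,k,\ell$ be integers with $\ell\ge 0$ and $2\ell<k$. Suppose $\mathcal{F}\subset\binom{[n]}{k}$ satisfies $|F\cap F'|\ne\ell$ for every pair of sets $F,F'\in\mathcal{F}$. If $k-\ell$ does not divide $\ell!$, then $$|\mathcal{F}|\le\binom{n}{k-\ell-1}.$$ In particular, this holds when $\ell<\log k/\log\log k$, where $\log$ is the natural logarithm.
   Context: Notation: $[n]=\{1,\dots,n\}$ and $\binom{[n]}{k}$ is the set of all $k$-element subsets of $[n]$. *)

theory Defs
  imports Complex_Main "HOL-Library.Ramsey"
begin

end

theory Submission
  imports Defs "HOL-Computational_Algebra.Formal_Power_Series"
begin

text \<open>
  Put \<open>q = k - l\<close>.  The bound is an instance of the linear algebra method of
  Frankl and Wilson, in which the usual assumption that \<open>q\<close> is a prime power is relaxed by choosing the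
  polynomial more carefully.  Consider the integer-valued polynomial
  \<open>f x = (x - l - 1) gchoose (q - 1)\<close> of degree \<open>q - 1\<close>.  It satisfies \<open>f k = 1\<close>, it vanishes at
  the integers strictly between \<open>l\<close> and \<open>k\<close>, and \<open>f (l - j) = \<plusminus>((q - 1 + j) choose j)\<close> for
  \<open>1 \<le> j \<le> l\<close>.  If \<open>q\<close> does not divide \<open>l!\<close>, then some prime \<open>p\<close> has a higher exponent in \<open>q\<close> than in
  \<open>l!\<close>, hence than in each such \<open>j\<close>; as \<open>j * ((q - 1 + j) choose j)\<close> is a multiple of \<open>q\<close>, the
  prime \<open>p\<close> divides the binomial coefficient
  (\<open>prime_dvd_binomial_if_multiplicity_less\<close>).  So, modulo \<open>p\<close>, the matrix
  \<open>f (card (A \<inter> B))\<close> indexed by the family is the identity.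

  On the other hand its rank is at most \<open>n choose (q - 1)\<close>: the function \<open>f\<close> is a combination of the
  \<open>x choose j\<close> with \<open>j \<le> q - 1\<close>, the number \<open>card (A \<inter> B) choose j\<close> counts the \<open>j\<close>-sets inside both \<open>A\<close>
  and \<open>B\<close>, and since all members have the same size, a linear relation between the members that is
  seen by no \<open>(q - 1)\<close>-set is seen by no smaller set either (\<open>incidence_relation_downward\<close>).
  Instead of comparing ranks over two fields, \<open>modular_Frankl_Wilson\<close> works with one
  integer relation whose coefficients are not all divisible by \<open>p\<close>.

  The second claim reduces to the first one: if \<open>l \<ge> 3\<close> and \<open>l < ln k / ln (ln k)\<close>, then
  \<open>(ln k) ^ l < k\<close>, and as \<open>l < ln k\<close> unless \<open>k\<close> is small, \<open>k\<close> exceeds \<open>l ^ l \<ge> l! + l\<close>; so \<open>k - l\<close> is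
  too large to divide \<open>l!\<close>.  The small cases are immediate.
\<close>

section \<open>Integer relations\<close>

text \<open>Elimination of one unknown per equation; cross-multiplying instead of dividing keeps the
  coefficients integral.\<close>

lemma homogeneous_system_nontrivial_solution:
  fixes a :: "'e \<Rightarrow> 'v \<Rightarrow> int"
  assumes "finite E" "finite V" "card E < card V"
  shows "\<exists>c. (\<exists>v\<in>V. c v \<noteq> 0) \<and> (\<forall>e\<in>E. (\<Sum>v\<in>V. c v * a e v) = 0)"
  using assms
proof (induction E arbitrary: V a rule: finite_induct)
  case empty
  then have "V \<noteq> {}" by auto
  then show ?case by (intro exI[of _ "\<lambda>_. 1"]) auto
next
  case (insert e E)
  show ?case
  proof (cases "\<forall>v\<in>V. a e v = 0")
    case True
    have "card E < card V" using insert by simp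
    from insert.IH[OF insert.prems(1) this, of a] True show ?thesis by auto
  next
    case False
    then obtain w where w: "w \<in> V" "a e w \<noteq> 0" by auto
    let ?W = "V - {w}"
    have "card E < card ?W" using insert w by simp
    from insert.IH[OF _ this, of "\<lambda>e' v. a e w * a e' v - a e' w * a e v"] insert.prems
    obtain c where c: "\<exists>v\<in>?W. c v \<noteq> 0"
      and eq: "\<forall>e'\<in>E. (\<Sum>v\<in>?W. c v * (a e w * a e' v - a e' w * a e v)) = 0"
      by auto
    define s where "s = (\<Sum>v\<in>?W. c v * a e v)"
    define d where "d = (\<lambda>v. if v = w then - s else a e w * c v)"
    have split: "(\<Sum>v\<in>V. d v * a e' v) = a e w * (\<Sum>v\<in>?W. c v * a e' v) - s * a e' w" for e'
    proof -
      have "(\<Sum>v\<in>?W. d v * a e' v) = a e w * (\<Sum>v\<in>?W. c v * a e' v)"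
        unfolding sum_distrib_left by (intro sum.cong) (auto simp: d_def)
      then show ?thesis using insert.prems(1) w(1) by (simp add: sum.remove[of V w] d_def)
    qed
    have "(\<Sum>v\<in>V. d v * a e v) = 0" unfolding split s_def by simp
    moreover have "(\<Sum>v\<in>V. d v * a e' v) = 0" if "e' \<in> E" for e'
    proof -
      have "(\<Sum>v\<in>?W. c v * (a e w * a e' v - a e' w * a e v))
          = a e w * (\<Sum>v\<in>?W. c v * a e' v) - a e' w * s"
        unfolding s_def sum_distrib_left sum_subtractf[symmetric]
        by (intro sum.cong) (auto simp: algebra_simps)
      then show ?thesis using eq that unfolding split by (simp add: mult.commute)
    qed
    moreover have "\<exists>v\<in>V. d v \<noteq> 0" using c w by (auto simp: d_def)
    ultimately show ?thesis by auto
  qed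
qed

text \<open>Dividing a nontrivial solution by the greatest common divisor of its entries makes it primitive.\<close>

lemma homogeneous_system_primitive_solution:
  fixes a :: "'e \<Rightarrow> 'v \<Rightarrow> int"
  assumes "finite E" "finite V" "card E < card V" and p: "\<not> p dvd 1"
  shows "\<exists>c. (\<exists>v\<in>V. \<not> p dvd c v) \<and> (\<forall>e\<in>E. (\<Sum>v\<in>V. c v * a e v) = 0)"
proof -
  obtain c where c: "\<exists>v\<in>V. c v \<noteq> 0" "\<forall>e\<in>E. (\<Sum>v\<in>V. c v * a e v) = 0"
    using homogeneous_system_nontrivial_solution[OF assms(1-3)] by blast
  define g where "g = Gcd (c ` V)"
  define d where "d = (\<lambda>v. c v div g)"
  have g0: "g \<noteq> 0" using c(1) by (auto simp: g_def Gcd_0_iff)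
  have cd: "c v = g * d v" if "v \<in> V" for v
    using that by (simp add: d_def g_def)
  have "(\<Sum>v\<in>V. d v * a e v) = 0" if "e \<in> E" for e
  proof -
    have "g * (\<Sum>v\<in>V. d v * a e v) = (\<Sum>v\<in>V. c v * a e v)"
      unfolding sum_distrib_left by (intro sum.cong) (auto simp: cd)
    also have "\<dots> = 0" using c(2) that by blast
    finally show ?thesis using g0 by simp
  qed
  moreover have "\<exists>v\<in>V. \<not> p dvd d v"
  proof (rule ccontr)
    assume "\<not> ?thesis"
    then have "g * p dvd c v" if "v \<in> V" for v using that by (simp add: cd)
    then have "g * p dvd Gcd (c ` V)" by (intro Gcd_greatest) auto
    then have "g * p dvd g * 1" by (simp add: g_def)
    then show False using g0 p by (simp only: dvd_mult_cancel_left) simp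
  qed
  ultimately show ?thesis by (intro exI[of _ d]) simp
qed

section \<open>The Frankl-Wilson bound for uniform families\<close>

lemma card_sets_between:
  assumes "finite A" "S \<subseteq> A" "card S \<le> s"
  shows "card {T. S \<subseteq> T \<and> T \<subseteq> A \<and> card T = s} = (card A - card S) choose (s - card S)"
proof -
  have fS: "finite S" using assms finite_subset by auto
  have "bij_betw (\<lambda>U. S \<union> U) {U. U \<subseteq> A - S \<and> card U = s - card S}
          {T. S \<subseteq> T \<and> T \<subseteq> A \<and> card T = s}"
  proof (rule bij_betw_byWitness[where f' = "\<lambda>T. T - S"])
    have "card (S \<union> U) = s" if "U \<subseteq> A - S" "card U = s - card S" for U
    proof -
      have "finite U" using that assms finite_subset by blast
      moreover have "S \<inter> U = {}" using that by auto
      ultimately show ?thesis using that fS assms by (simp add: card_Un_disjoint)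
    qed
    then show "(\<lambda>U. S \<union> U) ` {U. U \<subseteq> A - S \<and> card U = s - card S}
        \<subseteq> {T. S \<subseteq> T \<and> T \<subseteq> A \<and> card T = s}" using assms(2) by auto
    show "(\<lambda>T. T - S) ` {T. S \<subseteq> T \<and> T \<subseteq> A \<and> card T = s}
        \<subseteq> {U. U \<subseteq> A - S \<and> card U = s - card S}"
      using fS by (auto simp: card_Diff_subset)
  qed auto
  then have "card {T. S \<subseteq> T \<and> T \<subseteq> A \<and> card T = s} = card {U. U \<subseteq> A - S \<and> card U = s - card S}"
    by (simp add: bij_betw_same_card)
  then show ?thesis using assms fS by (simp add: n_subsets card_Diff_subset)
qed

text \<open>Summing the relation over all \<open>s\<close>-sets \<open>T \<supseteq> S\<close> counts each member \<open>A \<supseteq> S\<close> equally often,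
  namely \<open>(k - card S) choose (s - card S)\<close> times; this is where uniformity is used.\<close>

lemma incidence_relation_downward:
  fixes c :: "'a set \<Rightarrow> int"
  assumes X: "finite X" and F: "F \<subseteq> nsets X k" and sk: "s \<le> k"
    and rel: "\<And>T. T \<in> nsets X s \<Longrightarrow> (\<Sum>A | A \<in> F \<and> T \<subseteq> A. c A) = 0"
    and S: "card S \<le> s"
  shows "(\<Sum>A | A \<in> F \<and> S \<subseteq> A. c A) = 0"
proof -
  have finF: "finite F" using F X finite_imp_finite_nsets finite_subset by blast
  let ?TT = "{T \<in> nsets X s. S \<subseteq> T}"
  have finT: "finite ?TT" using finite_imp_finite_nsets[OF X, of s] by simp
  have "(k - card S) choose (s - card S) = card {T \<in> ?TT. T \<subseteq> A}"
    if "A \<in> {A \<in> F. S \<subseteq> A}" for A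
  proof -
    have A: "finite A" "A \<subseteq> X" "card A = k" "S \<subseteq> A" using that F by (auto simp: nsets_def)
    then have "{T \<in> ?TT. T \<subseteq> A} = {T. S \<subseteq> T \<and> T \<subseteq> A \<and> card T = s}"
      by (auto simp: nsets_def intro: finite_subset)
    then show ?thesis using card_sets_between[OF A(1) A(4) S] A(3) by simp
  qed
  then have "int ((k - card S) choose (s - card S)) * (\<Sum>A | A \<in> F \<and> S \<subseteq> A. c A)
      = (\<Sum>A | A \<in> F \<and> S \<subseteq> A. \<Sum>T | T \<in> ?TT \<and> T \<subseteq> A. c A)"
    by (simp add: sum_distrib_left)
  also have "\<dots> = (\<Sum>T\<in>?TT. \<Sum>A | A \<in> {A. A \<in> F \<and> S \<subseteq> A} \<and> T \<subseteq> A. c A)"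
    using finF finT by (intro sum.swap_restrict) auto
  also have "\<dots> = (\<Sum>T\<in>?TT. \<Sum>A | A \<in> F \<and> T \<subseteq> A. c A)"
    by (intro sum.cong refl) auto
  also have "\<dots> = 0" using rel by (intro sum.neutral) auto
  finally have "int ((k - card S) choose (s - card S)) * (\<Sum>A | A \<in> F \<and> S \<subseteq> A. c A) = 0" .
  moreover have "0 < (k - card S) choose (s - card S)" using sk S by (intro zero_less_binomial) simp
  ultimately show ?thesis by simp
qed

text \<open>Double counting of the \<open>j\<close>-sets inside both \<open>A\<close> and \<open>B\<close>.\<close>

lemma sum_binomial_card_Int:
  fixes c :: "'a set \<Rightarrow> int"
  assumes "finite F" "finite B"
  shows "(\<Sum>A\<in>F. c A * int (card (A \<inter> B) choose j))
       = (\<Sum>S\<in>nsets B j. \<Sum>A | A \<in> F \<and> S \<subseteq> A. c A)"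
proof -
  have "{S. S \<in> nsets B j \<and> S \<subseteq> A} = {S. S \<subseteq> A \<inter> B \<and> card S = j}" for A
    using assms(2) by (auto simp: nsets_def intro: finite_subset)
  then have "card {S. S \<in> nsets B j \<and> S \<subseteq> A} = card (A \<inter> B) choose j" for A
    using n_subsets[of "A \<inter> B" j] assms(2) by (simp only: finite_Int simp_thms)
  then have "(\<Sum>A\<in>F. c A * int (card (A \<inter> B) choose j))
      = (\<Sum>A\<in>F. \<Sum>S | S \<in> nsets B j \<and> S \<subseteq> A. c A)" by (simp add: mult.commute)
  also have "\<dots> = (\<Sum>S\<in>nsets B j. \<Sum>A | A \<in> F \<and> S \<subseteq> A. c A)"
    using assms by (intro sum.swap_restrict) (auto simp: finite_imp_finite_nsets)
  finally show ?thesis .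
qed

text \<open>The function \<open>f\<close> is an integer-valued polynomial of degree at most \<open>s\<close>, given by its integer
  coordinates \<open>b\<close> in the binomial basis. If the family were larger than the number of \<open>s\<close>-sets, some
  integer relation \<open>c\<close>, with coefficients not all divisible by \<open>p\<close>, would be seen by no \<open>s\<close>-set,
  hence would be annihilated by the matrix \<open>f (card (A \<inter> B))\<close>; but this matrix is invertible modulo \<open>p\<close>.\<close>

lemma modular_Frankl_Wilson:
  fixes f :: "nat \<Rightarrow> int" and b :: "nat \<Rightarrow> int" and p :: int
  assumes X: "finite X" and F: "F \<subseteq> nsets X k" and sk: "s \<le> k" and p: "prime p"
    and f: "\<And>x. f x = (\<Sum>j\<le>s. b j * int (x choose j))"
    and diag: "\<not> p dvd f k"
    and off: "\<And>A B. A \<in> F \<Longrightarrow> B \<in> F \<Longrightarrow> A \<noteq> B \<Longrightarrow> p dvd f (card (A \<inter> B))"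
  shows "card F \<le> card X choose s"
proof (rule ccontr)
  assume "\<not> ?thesis"
  moreover have "card (nsets X s) = card X choose s"
    using X by (metis (no_types, lifting) Collect_cong finite_subset n_subsets nsets_def)
  ultimately have less: "card (nsets X s) < card F" by simp
  have finF: "finite F" using F X finite_imp_finite_nsets finite_subset by blast
  have "\<not> p dvd 1" using p not_prime_unit by blast
  from homogeneous_system_primitive_solution[OF finite_imp_finite_nsets[OF X] finF less this,
      of "\<lambda>T A. if T \<subseteq> A then 1 else 0"]
  obtain c where c: "\<exists>A\<in>F. \<not> p dvd c A"
    and rel0: "\<forall>T\<in>nsets X s. (\<Sum>A\<in>F. c A * (if T \<subseteq> A then 1 else 0)) = 0"
    by (elim exE conjE)
  have rel: "(\<Sum>A | A \<in> F \<and> T \<subseteq> A. c A) = 0" if "T \<in> nsets X s" for T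
    using rel0 that finF by (simp add: sum.inter_filter if_distrib cong: if_cong)
  obtain B where B: "B \<in> F" "\<not> p dvd c B" using c by blast
  then have Bk: "finite B" "card B = k" using F by (auto simp: nsets_def)
  have "(\<Sum>A\<in>F. c A * int (card (A \<inter> B) choose j)) = 0" if "j \<le> s" for j
    unfolding sum_binomial_card_Int[OF finF Bk(1)]
    using that incidence_relation_downward[OF X F sk rel]
    by (intro sum.neutral) (auto simp: nsets_def)
  then have "(\<Sum>j\<le>s. b j * (\<Sum>A\<in>F. c A * int (card (A \<inter> B) choose j))) = 0" by simp
  also have "(\<Sum>j\<le>s. b j * (\<Sum>A\<in>F. c A * int (card (A \<inter> B) choose j)))
      = (\<Sum>A\<in>F. c A * f (card (A \<inter> B)))"
    unfolding f sum_distrib_left by (subst sum.swap) (simp add: mult.left_commute)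
  also have "\<dots> = c B * f k + (\<Sum>A\<in>F - {B}. c A * f (card (A \<inter> B)))"
    using finF B Bk by (simp add: sum.remove)
  finally have "c B * f k + (\<Sum>A\<in>F - {B}. c A * f (card (A \<inter> B))) = 0" .
  then have "c B * f k = - (\<Sum>A\<in>F - {B}. c A * f (card (A \<inter> B)))" by linarith
  moreover have "p dvd (\<Sum>A\<in>F - {B}. c A * f (card (A \<inter> B)))"
    using off B by (intro dvd_sum) auto
  ultimately have "p dvd c B * f k" by simp
  then show False using B diag p by (simp add: prime_dvd_mult_iff)
qed

section \<open>A polynomial that is an indicator modulo a prime\<close>

text \<open>The polynomial \<open>(x - l - 1) gchoose s\<close> in the coordinates of the binomial basis, obtained from
  Vandermonde's identity \<open>(x + a) gchoose s = (\<Sum>j\<le>s. (x choose j) * (a gchoose (s - j)))\<close> at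
  \<open>a = - (l + 1)\<close>; in this form its values at natural numbers are visibly integers.\<close>

definition shifted_binomial :: "nat \<Rightarrow> nat \<Rightarrow> nat \<Rightarrow> int" where
  "shifted_binomial l s x
     = (\<Sum>j\<le>s. (- 1) ^ (s - j) * int ((l + (s - j)) choose (s - j)) * int (x choose j))"

lemma of_int_shifted_binomial:
  "rat_of_int (shifted_binomial l s x) = (of_nat x - of_nat l - 1) gchoose s"
proof -
  have neg: "(- (of_nat l + 1) :: rat) gchoose m = (- 1) ^ m * of_nat ((l + m) choose m)" for m
  proof -
    have "of_nat l + 1 + of_nat m - 1 = (of_nat (l + m) :: rat)" by simp
    then show ?thesis by (simp only: gbinomial_minus binomial_gbinomial)
  qed
  have "rat_of_int (shifted_binomial l s x)
      = (\<Sum>j\<le>s. (- 1) ^ (s - j) * of_nat ((l + (s - j)) choose (s - j)) * of_nat (x choose j))"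
    unfolding shifted_binomial_def by simp
  also have "\<dots> = (\<Sum>j\<le>s. (of_nat x gchoose j) * ((- (of_nat l + 1)) gchoose (s - j)))"
    unfolding neg by (simp only: binomial_gbinomial mult.commute)
  also have "\<dots> = (of_nat x + - (of_nat l + 1)) gchoose s"
    unfolding atMost_atLeast0 by (rule gbinomial_Vandermonde)
  also have "of_nat x + - (of_nat l + 1) = (of_nat x - of_nat l - 1 :: rat)" by simp
  finally show ?thesis .
qed

lemma shifted_binomial_greater:
  assumes "l < x"
  shows "shifted_binomial l s x = int ((x - l - 1) choose s)"
proof -
  have "of_nat x - of_nat l - 1 = rat_of_nat (x - l - 1)"
    using assms by (simp add: of_nat_diff algebra_simps)
  then have "rat_of_int (shifted_binomial l s x) = rat_of_int (int ((x - l - 1) choose s))"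
    by (simp only: of_int_shifted_binomial binomial_gbinomial of_int_of_nat_eq)
  then show ?thesis by (simp only: of_int_eq_iff)
qed

text \<open>Here the upper index \<open>x - l - 1\<close> is negative, and negating it turns the coefficient into an
  ordinary one.\<close>

lemma shifted_binomial_le:
  assumes "x \<le> l"
  shows "shifted_binomial l s x = (- 1) ^ s * int ((s + (l - x)) choose s)"
proof -
  have "of_nat x - of_nat l - 1 = - (of_nat (l - x) + 1 :: rat)"
    using assms by (simp add: of_nat_diff)
  moreover have "of_nat (l - x) + 1 + of_nat s - 1 = (of_nat (s + (l - x)) :: rat)" by simp
  ultimately have "rat_of_int (shifted_binomial l s x) = (- 1) ^ s * of_nat ((s + (l - x)) choose s)"
    by (simp only: of_int_shifted_binomial gbinomial_minus binomial_gbinomial)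
  also have "\<dots> = rat_of_int ((- 1) ^ s * int ((s + (l - x)) choose s))" by simp
  finally show ?thesis by (simp only: of_int_eq_iff)
qed

text \<open>Compare the exponents of \<open>p\<close> in \<open>j * ((q - 1 + j) choose j) = q * ((q - 1 + j) choose (j - 1))\<close>.\<close>

lemma prime_dvd_binomial_if_multiplicity_less:
  fixes p q j :: nat
  assumes p: "prime p" and j: "0 < j" and less: "multiplicity p j < multiplicity p q"
  shows "p dvd (q - 1 + j) choose j"
proof (rule ccontr)
  let ?C = "(q - 1 + j) choose j"
  assume "\<not> p dvd ?C"
  then have C0: "multiplicity p ?C = 0" by (rule not_dvd_imp_multiplicity_0)
  have q: "0 < q" using less by (cases q) auto
  have "j * ?C = q * ((q - 1 + j) choose (j - 1))"
  proof -
    obtain i where i: "j = Suc i" using j by (cases j) auto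
    obtain r where r: "q = Suc r" using q by (cases q) auto
    show ?thesis
      using binomial_absorption[of i "r + i + 1"] binomial_absorb_comp[of "r + i + 1" i]
      by (simp add: i r)
  qed
  then have "q dvd j * ?C" by simp
  then have "multiplicity p q \<le> multiplicity p (j * ?C)"
    using j by (intro dvd_imp_multiplicity_le) auto
  also have "\<dots> = multiplicity p j"
    using p j C0 by (simp add: prime_elem_multiplicity_mult_distrib)
  finally show False using less by simp
qed

lemma prime_dvd_shifted_binomial:
  fixes p k l x :: nat
  assumes p: "prime p" and x: "x < k" "x \<noteq> l" and lk: "l < k"
    and less: "multiplicity p (fact l) < multiplicity p (k - l)"
  shows "int p dvd shifted_binomial l (k - l - 1) x"
proof (cases "l < x")
  case True
  then show ?thesis using x by (simp add: shifted_binomial_greater binomial_eq_0)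
next
  case False
  define j where "j = l - x"
  have j: "0 < j" "j \<le> l" using False x by (auto simp: j_def)
  have "multiplicity p j \<le> multiplicity p (fact l :: nat)"
    using j by (intro dvd_imp_multiplicity_le dvd_fact) auto
  then have "p dvd (k - l - 1 + j) choose j"
    using prime_dvd_binomial_if_multiplicity_less[OF p j(1), of "k - l"] less by simp
  also have "(k - l - 1 + j) choose j = (k - l - 1 + j) choose (k - l - 1)"
    using binomial_symmetric[of j "k - l - 1 + j"] by simp
  finally have "int p dvd int ((k - l - 1 + j) choose (k - l - 1))" by simp
  then show ?thesis using False by (simp add: shifted_binomial_le j_def)
qed

lemma card_le_if_no_intersection_size:
  fixes k l :: nat
  assumes X: "finite X" and lk: "l < k" and F: "F \<subseteq> nsets X k"
    and no_l: "\<forall>A\<in>F. \<forall>B\<in>F. card (A \<inter> B) \<noteq> l"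
    and ndvd: "\<not> (k - l) dvd fact l"
  shows "card F \<le> card X choose (k - l - 1)"
proof -
  obtain p :: nat where p: "prime p" and less: "multiplicity p (fact l) < multiplicity p (k - l)"
    using multiplicity_le_imp_dvd[of "k - l" "fact l"] ndvd lk by (metis diff_is_0_eq not_le)
  let ?f = "shifted_binomial l (k - l - 1)"
  show ?thesis
  proof (rule modular_Frankl_Wilson[OF X F, of "k - l - 1" "int p" ?f])
    show "?f x = (\<Sum>j\<le>k - l - 1. (- 1) ^ (k - l - 1 - j) *
        int ((l + (k - l - 1 - j)) choose (k - l - 1 - j)) * int (x choose j))" for x
      by (rule shifted_binomial_def)
    show "\<not> int p dvd ?f k" using p lk by (auto simp: shifted_binomial_greater)
    show "int p dvd ?f (card (A \<inter> B))" if "A \<in> F" "B \<in> F" "A \<noteq> B" for A B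
    proof -
      have AB: "finite A" "card A = k" "finite B" "card B = k"
        using that F by (auto simp: nsets_def)
      have "A \<inter> B \<subset> A" using AB that(3) by (metis card_subset_eq inf.absorb_iff1 inf_le1 psubsetI)
      then have "card (A \<inter> B) < k" using AB psubset_card_mono by blast
      then show ?thesis
        using prime_dvd_shifted_binomial[OF p _ _ lk less] no_l that by blast
    qed
  qed (use p in auto)
qed

section \<open>Small forbidden intersections\<close>

lemma fact_add_self_le_power_self:
  fixes l :: nat
  assumes "2 \<le> l"
  shows "fact l + l \<le> l ^ l"
proof -
  obtain m where m: "l = Suc m" "1 \<le> m" using assms by (cases l) auto
  have "fact m \<le> m ^ m" using fact_le_power[where 'a = nat, of m] by simp
  also have "\<dots> < Suc m ^ m" using m by (intro power_strict_mono) auto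
  finally have "Suc m * (fact m + 1) \<le> Suc m * Suc m ^ m" by (intro mult_left_mono) auto
  then show ?thesis by (simp add: m algebra_simps)
qed

text \<open>The bound \<open>exp x \<le> 1 + x + x^2\<close> is only sharp enough for small \<open>x\<close>; \<open>x = 1 / 12\<close> suffices.\<close>

lemma two_thirds_le_ln_2: "2 / 3 \<le> ln (2 :: real)"
proof -
  have "exp (2 / 3) = exp (1 / 12 :: real) ^ 8"
    using exp_of_nat_mult[of 8 "1 / 12 :: real"] by simp
  also have "\<dots> \<le> (157 / 144) ^ 8"
    using exp_bound[of "1 / 12"] by (intro power_mono) (auto simp: power2_eq_square)
  also have "\<dots> \<le> 2" by (simp add: power_divide)
  finally show ?thesis by (simp only: ln_ge_iff zero_less_numeral)
qed

text \<open>The function \<open>L / ln L\<close> exceeds \<open>3\<close> for \<open>L\<close> close to \<open>1\<close>; on \<open>[2, 3]\<close> it does not.  There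
  \<open>ln L \<ge> ln 2 + 1 - 2 / L\<close> with \<open>ln 2 \<ge> 2 / 3\<close> reduces the claim to \<open>(L - 2) * (L - 3) \<le> 0\<close>.\<close>

lemma le_three_times_ln:
  fixes L :: real
  assumes "2 \<le> L" "L \<le> 3"
  shows "L \<le> 3 * ln L"
proof -
  have "ln (2 / L) \<le> 2 / L - 1" using assms by (intro ln_le_minus_one) auto
  moreover have "ln (2 / L) = ln 2 - ln L" using assms by (simp add: ln_div)
  ultimately have "5 - 6 / L \<le> 3 * ln L" using two_thirds_le_ln_2 by simp
  moreover have "L \<le> 5 - 6 / L"
  proof -
    have "(L - 2) * (L - 3) \<le> 0" using assms by (intro mult_nonneg_nonpos) auto
    then show ?thesis using assms by (simp add: field_simps)
  qed
  ultimately show ?thesis by linarith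
qed

text \<open>For \<open>k \<le> 2\<close> the quotient of logarithms is not positive.  For \<open>k \<ge> 3\<close> and \<open>l \<le> 2\<close> the
  hypothesis \<open>2 * l < k\<close> gives \<open>l! < k - l\<close>.  For \<open>l \<ge> 3\<close> and \<open>k \<ge> 8\<close>, so
  that \<open>ln k \<ge> ln 8 \<ge> 2\<close>, the logarithmic bound gives \<open>l < ln k\<close> and then \<open>l ^ l < k\<close>.  In the
  remaining case \<open>k = 7\<close>, \<open>l = 3\<close>, the number \<open>4\<close> does not divide \<open>6\<close>.\<close>

lemma not_dvd_fact_if_less_log_ratio:
  fixes k l :: nat
  assumes k: "2 * l < k" and less: "real l < ln (real k) / ln (ln (real k))"
  shows "\<not> (k - l) dvd fact l"
proof -
  define L where "L = ln (real k)"
  have "k \<noteq> 1" using less by auto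
  moreover have "k \<noteq> 2"
  proof
    assume k2: "k = 2"
    have "ln (ln (2::real)) < 0" using ln_2_less_1 by simp
    then have "ln (2::real) / ln (ln 2) < 0" by (simp add: divide_pos_neg)
    then show False using less k2 by simp
  qed
  ultimately have k3: "3 \<le> k" using k by linarith
  consider "l = 0" | "l = 1" | "l = 2" | "l = 3" "k = 7" | "3 \<le> l" "8 \<le> k"
    using k by linarith
  then show ?thesis
  proof cases
    case 5
    have "3 * ln 2 = ln (8::real)" using ln_realpow[of 2 3] by simp
    also have "\<dots> \<le> L" using 5 by (simp add: L_def)
    finally have L2: "2 \<le> L" using two_thirds_le_ln_2 by simp
    then have lnL: "0 < ln L" by simp
    have prod: "real l * ln L < L" using less lnL by (simp add: L_def pos_less_divide_eq)
    have "3 < L"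
    proof (rule ccontr)
      assume "\<not> 3 < L"
      then have "L \<le> 3 * ln L" using L2 le_three_times_ln by simp
      also have "\<dots> \<le> real l * ln L" using 5 lnL by (intro mult_right_mono) auto
      finally show False using prod by simp
    qed
    then have "exp 1 < L" using exp_le by linarith
    then have "1 < ln L" using L2 ln_less_cancel_iff[of "exp 1" L] by simp
    then have "real l * 1 \<le> real l * ln L" by (intro mult_left_mono) auto
    then have "real l < L" using prod by simp
    then have "real l ^ l \<le> L ^ l" by (intro power_mono) auto
    also have "\<dots> = exp (real l * ln L)" using L2 by (simp add: exp_of_nat_mult)
    also have "\<dots> < exp L" using prod by simp
    also have "\<dots> = real k" using k3 by (simp add: L_def)
    finally have "l ^ l < k" by (metis of_nat_less_iff of_nat_power)
    then have "fact l < k - l" using fact_add_self_le_power_self[of l] 5 by linarith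
    then show ?thesis by (simp add: nat_dvd_not_less)
  qed (use k k3 in \<open>auto simp: fact_numeral dest!: dvd_imp_le\<close>)
qed

theorem theorem10:
  fixes n k l :: nat and F :: "nat set set"
  assumes "2 * l < k"
    and "F \<subseteq> nsets {1..n} k"
    and "\<forall>A\<in>F. \<forall>B\<in>F. card (A \<inter> B) \<noteq> l"
  shows "(\<not> (k - l) dvd fact l \<longrightarrow> card F \<le> n choose (k - l - 1)) \<and>
         (real l < ln (real k) / ln (ln (real k)) \<longrightarrow> card F \<le> n choose (k - l - 1))"
proof -
  have "card F \<le> n choose (k - l - 1)" if "\<not> (k - l) dvd fact l"
    using card_le_if_no_intersection_size[of "{1..n}" l k F] assms that by simp
  then show ?thesis using not_dvd_fact_if_less_log_ratio[OF assms(1)] by blast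
qed

end
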